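(* Let $n\ge 2$, $m\ge 1$, let $g_i:\mathbb{R}^m\to\mathbb{R}$ ($i=1,\dots,n$) be convex and continuously differentiable with $l_i$-Lipschitz gradient, let $C_i\in\mathbb{R}^m$, let $h>0$, and let the communication graphs, the switching signal $\delta$ and the triggering parameters be as in the context. Consider the sequences generated by the dynamic event-triggered algorithm described in the context, and the estimation errors $e_i(k)=\nabla g_i(X_i(k))-\nabla g_i(\hat X_i(k))$. Then there exists a nonincreasing and summable real sequence $\{\alpha(k)\}_{k\ge0}$ such that $$\|e_i(k)\|\le \alpha(k)\qquad\text{for all } i\in\{1,\dots,n\}\text{ and all } k\ge 0.$$
   Context: **Graphs.** $\mathbb{G}_1,\dots,\mathbb{G}_r$ are finitely many undirected connected graphs on the node set $\{1,\dots,n\}$. $\mathbb{G}_p$ has symmetric adjacency matrix $A_p=[a^p_{ij}]$ with $a_{ij}^p>0$ if $i,j$ are neighbors in $\mathbb{G}_p$ and $a_{ij}^p=0$ otherwise. The switching signal is an arbitrary map $\delta$ from the time indices $k=0,1,2,\dots$ to $\{1,\dots,r\}$; at time $k$ the graph $\mathbb{G}_{\delta(k)}$ is active. **Parameters.** For each agent $i$: $\beta_i\in(0,1)$, $\theta_i\in(0,1)$, $\rho_i>0$, $c_i>1$, $0<\tau_i<1-\theta_i$, $\eta_i(0)>0$. Write $\beta_i(k)=\beta_i^k$ (the $k$-th power of $\beta_i$). **Algorithm.** Initialization: $X_i(0)\in\mathbb{R}^m$ arbitrary, $\hat X_i(0)=X_i(0)$, $Z_i(-1)=0$. For $k=0,1,2,\dots$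 and all $i$: $$Z_i(k)=Z_i(k-1)+\sum_{j=1}^n a_{ij}^{\delta(k)}\big(\nabla g_i(\hat X_i(k))-\nabla g_j(\hat X_j(k))\big),$$ $$X_i(k+1)=C_i-2hZ_i(k)+hZ_i(k-1).$$ **Triggering rule.** $\hat X_i(k)=X_i(k_i^t)$ for $k_i^t\le k<k_i^{t+1}$, where $k_i^0=0$ and $$k_i^{t+1}=\min\{k>k_i^t:\ \|\nabla g_i(X_i(k))-\nabla g_i(X_i(k_i^t))\|\ \ge\ \theta_i\eta_i(k)+c_i\beta_i(k)+\varphi_i(k)\}$$ (with $k_i^{t+1}=\infty$ if there is no such $k$). Here $$\varphi_i(k)=\frac{\rho_i\beta_i(k)}{1+\|r_i(k)\|},$$ where $r_i(k)=\sum_{j=1}^n a_{ij}^{\delta(k)}(\nabla g_i(\hat X_i)-\nabla g_j(\hat X_j))$ is the local gradient-disagreement residual, computed, for use in $\varphi_i(k)$, from the most recently stored values before the triggering test at time $k$ (i.e. $\hat X_i(k-1),\hat X_j(k-1)$ for $k\ge1$, and $\hat X_i(0),\hat X_j(0)$ for $k=0$). **Dynamic threshold.** With $e_i(k)=\nabla g_i(X_i(k))-\nabla g_i(\hat X_i(k))$ (so $e_i(k)=0$ at trigger times), $$\eta_i(k+1)=(1-\tau_i)\eta_i(k)+c_i\beta_i(k)+\varphi_i(k)-\|e_i(k)\|.$$ $\|\cdot\|$ is the Euclidean norm. *)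

theory Defs
  imports "HOL-Analysis.Analysis" "HOL-Library.Extended_Nat" "Graph_Theory.Graph_Theory"
begin

(* Agents are the elements of the finite type 'n, so the node set is UNIV.  In the AFP's terms a
   pair_graph is a finite simple undirected graph: each edge is stored as the two arcs (i, j) and
   (j, i), and there are no loops. *)
definition connected_graph_on_agents :: "'n::finite pair_pre_digraph \<Rightarrow> bool" where
  "connected_graph_on_agents G \<longleftrightarrow>
     pair_graph G \<and> pverts G = UNIV \<and> Digraph_Component.connected (with_proj G)"

definition weighted_adjacency_matrix :: "'n::finite pair_pre_digraph \<Rightarrow> real^'n^'n \<Rightarrow> bool" where
  "weighted_adjacency_matrix G A \<longleftrightarrow>
     transpose A = A \<and>
     (\<forall>i j. if (i, j) \<in> parcs G then A $ i $ j > 0 else A $ i $ j = 0)"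

definition gradient_disagreement ::
    "real^'n^'n \<Rightarrow> ('n \<Rightarrow> 'v \<Rightarrow> 'v) \<Rightarrow> ('n \<Rightarrow> 'v) \<Rightarrow> 'n::finite \<Rightarrow> 'v::real_vector" where
  "gradient_disagreement A grad x i =
     (\<Sum>j\<in>UNIV. A $ i $ j *\<^sub>R (grad i (x i) - grad j (x j)))"

(* Inf is the minimum of a nonempty set of extended naturals, and Inf {} = \<infinity>; so the value is \<infinity>
   if the condition is never met after s, and in particular if s = \<infinity>. *)
definition next_trigger_time :: "(nat \<Rightarrow> bool) \<Rightarrow> enat \<Rightarrow> enat" where
  "next_trigger_time P s = Inf {enat k | k. s < enat k \<and> P k}"

end

theory Submission
  imports Defs
begin

text \<open>
  Outside the triggering instants the estimation error is below the triggering threshold, and at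
  these instants it vanishes.  Hence the threshold variable \<open>\<eta>\<close> stays nonnegative, because
  \<open>\<tau> + \<theta> < 1\<close>, and it satisfies \<open>\<eta> (k + 1) \<le> (1 - \<tau>) \<eta> k + (c + \<rho>) \<beta>\<^sup>k\<close>, which
  forces geometric decay at any rate strictly between \<open>max (1 - \<tau>) \<beta>\<close> and 1.  The threshold, and
  with it the error of each agent, then decays geometrically; summing over the agents gives \<open>\<alpha>\<close>.
\<close>

text \<open>Every candidate is at least \<open>eSuc s\<close>, so the strict inequality survives the
  infimum, also when there is no candidate and the value is \<open>\<infinity>\<close>.\<close>

lemma next_trigger_time_gt:
  assumes "s \<noteq> \<infinity>"
  shows "s < next_trigger_time P s"
proof -
  have "eSuc s \<le> next_trigger_time P s"
    unfolding next_trigger_time_def by (rule Inf_greatest) (auto intro: ileI1)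
  with assms show ?thesis
    by (cases s) (auto simp: eSuc_enat Suc_ile_eq)
qed

lemma not_before_next_trigger_time:
  assumes "s < enat k" "enat k < next_trigger_time P s"
  shows "\<not> P k"
proof
  assume "P k"
  with assms(1) have "next_trigger_time P s \<le> enat k"
    unfolding next_trigger_time_def by (auto intro: Inf_lower)
  with assms(2) show False by simp
qed

text \<open>If no interval contained \<open>k\<close>, every \<open>T t\<close> would stay at most
  \<open>k\<close>, hence finite, hence strictly increasing in \<open>t\<close>; but then
  \<open>T t\<close> is at least \<open>t\<close>, which is absurd for \<open>t = Suc k\<close>.
  Infinite values are allowed so that the last interval may be unbounded.\<close>

lemma exists_trigger_interval:
  fixes T :: "nat \<Rightarrow> enat"
  assumes T0: "T 0 = 0" and T_less: "\<And>t. T t \<noteq> \<infinity> \<Longrightarrow> T t < T (Suc t)"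
  shows "\<exists>t. T t \<le> enat k \<and> enat k < T (Suc t)"
proof (rule ccontr)
  assume "\<not> ?thesis"
  then have step: "T (Suc t) \<le> enat k" if "T t \<le> enat k" for t
    using that by (auto simp: not_less)
  have "enat t \<le> T t \<and> T t \<le> enat k" for t
  proof (induction t)
    case 0
    then show ?case by (simp add: T0 zero_enat_def[symmetric])
  next
    case (Suc t)
    then have "T t < T (Suc t)" by (intro T_less) (cases "T t"; auto)
    with Suc have "enat t < T (Suc t)" by (meson le_less_trans)
    with Suc step show ?case by (simp add: Suc_ile_eq)
  qed
  from this[of "Suc k"] show False by (metis Suc_n_not_le_n enat_ord_simps(1) order_trans)
qed

text \<open>Since \<open>b ^ k\<close> is at most \<open>s ^ k\<close>, the sequence
  \<open>M * s ^ k\<close> dominates the recursion as soon as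
  \<open>a * M + K \<le> M * s\<close>.\<close>

lemma geometric_bound:
  fixes u :: "nat \<Rightarrow> real"
  assumes a: "0 \<le> a" "a < s" and b: "0 \<le> b" "b \<le> s" and K: "0 \<le> K"
    and step: "\<And>k. u (Suc k) \<le> a * u k + K * b ^ k"
  shows "\<exists>M\<ge>0. \<forall>k. u k \<le> M * s ^ k"
proof -
  \<comment> \<open>\<open>K / (s - a)\<close> is the smallest solution of
    \<open>a * M + K \<le> M * s\<close>; the entry \<open>u 0\<close> starts the induction, and 0
    makes \<open>M\<close> nonnegative.\<close>
  define M where "M = max 0 (max (u 0) (K / (s - a)))"
  have "K / (s - a) \<le> M" by (simp add: M_def)
  then have "a * M + K \<le> M * s" using a by (simp add: field_simps)
  moreover have "u k \<le> M * s ^ k" if M: "a * M + K \<le> M * s" for k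
  proof (induction k)
    case 0
    then show ?case by (simp add: M_def)
  next
    case (Suc k)
    have "u (Suc k) \<le> a * (M * s ^ k) + K * s ^ k"
      using step[of k] mult_left_mono[OF Suc a(1)]
        mult_left_mono[OF power_mono[OF b(2,1), of k] K] by linarith
    also have "\<dots> = (a * M + K) * s ^ k" by (simp add: algebra_simps)
    also have "\<dots> \<le> M * s * s ^ k" using M a by (intro mult_right_mono) auto
    finally show ?case by (simp add: mult_ac)
  qed
  ultimately show ?thesis by (intro exI[of _ M]) (simp add: M_def)
qed

text \<open>This treats a single agent, with \<open>\<epsilon>\<close> the norm of its error; the
  coupling to its neighbors is hidden in \<open>\<phi>\<close>. The bound on
  \<open>\<epsilon>\<close> is a disjunction because at a triggering instant the error is 0, while
  the sign of the threshold is only settled in the proof.\<close>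

lemma dynamic_threshold_geometric_error:
  fixes \<eta> \<phi> \<epsilon> :: "nat \<Rightarrow> real"
  assumes \<beta>: "0 < \<beta>" "\<beta> < 1" and \<theta>: "0 < \<theta>" and \<tau>: "0 < \<tau>" "\<tau> < 1 - \<theta>"
    and c: "0 \<le> c" and \<eta>0: "0 \<le> \<eta> 0"
    and \<phi>: "\<And>k. 0 \<le> \<phi> k" "\<And>k. \<phi> k \<le> \<rho> * \<beta> ^ k"
    and \<epsilon>_nonneg: "\<And>k. 0 \<le> \<epsilon> k"
    and \<epsilon>: "\<And>k. \<epsilon> k = 0 \<or> \<epsilon> k \<le> \<theta> * \<eta> k + c * \<beta> ^ k + \<phi> k"
    and \<eta>: "\<And>k. \<eta> (Suc k) = (1 - \<tau>) * \<eta> k + c * \<beta> ^ k + \<phi> k - \<epsilon> k"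
  shows "\<exists>K s. 0 \<le> K \<and> 0 \<le> s \<and> s < 1 \<and> (\<forall>k. \<epsilon> k \<le> K * s ^ k)"
proof -
  have \<rho>: "0 \<le> \<rho>" using \<phi>[of 0] by simp
  have c\<beta>: "0 \<le> c * \<beta> ^ k" for k using c \<beta> by simp
  have \<eta>_nonneg: "0 \<le> \<eta> k" for k
  proof (induction k)
    case (Suc k)
    \<comment> \<open>Subtracting an error below the threshold leaves at least the first product; if
      the error is 0, the sum of both products, \<open>(1 - \<tau>) * \<eta> k\<close>,
      remains.\<close>
    have "0 \<le> (1 - \<tau> - \<theta>) * \<eta> k" "0 \<le> \<theta> * \<eta> k" using Suc \<tau> \<theta> by simp_all
    then show ?case
      using \<epsilon>[of k] \<phi>(1)[of k] c\<beta>[of k] unfolding \<eta> by (auto simp: algebra_simps)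
  qed (fact \<eta>0)
  \<comment> \<open>With \<open>\<eta>\<close> nonnegative the threshold is too, so the case of zero
    error is absorbed.\<close>
  have threshold: "\<epsilon> k \<le> \<theta> * \<eta> k + c * \<beta> ^ k + \<phi> k" for k
    using \<epsilon>[of k] \<phi>(1)[of k] c\<beta>[of k] mult_nonneg_nonneg[OF less_imp_le[OF \<theta>] \<eta>_nonneg[of k]]
    by linarith
  obtain s where s: "max (1 - \<tau>) \<beta> < s" "s < 1"
    using dense[of "max (1 - \<tau>) \<beta>" 1] \<tau> \<beta> by auto
  have "\<eta> (Suc k) \<le> (1 - \<tau>) * \<eta> k + (c + \<rho>) * \<beta> ^ k" for k
    using \<epsilon>_nonneg[of k] \<phi>(2)[of k] by (simp add: \<eta> algebra_simps)
  then obtain M where M: "0 \<le> M" "\<And>k. \<eta> k \<le> M * s ^ k"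
    using geometric_bound[of "1 - \<tau>" s \<beta> "c + \<rho>" \<eta>] s \<tau> \<theta> \<beta> c \<rho> by auto
  have "\<epsilon> k \<le> (\<theta> * M + c + \<rho>) * s ^ k" for k
  proof -
    have "\<beta> ^ k \<le> s ^ k" using s \<beta> by (intro power_mono) auto
    then have "(c + \<rho>) * \<beta> ^ k \<le> (c + \<rho>) * s ^ k" using c \<rho> by (intro mult_left_mono) auto
    then show ?thesis
      using threshold[of k] \<phi>(2)[of k] mult_left_mono[OF M(2)[of k] less_imp_le[OF \<theta>]]
      by (simp add: algebra_simps)
  qed
  then show ?thesis
    using s \<theta> \<beta> M(1) c \<rho> by (intro exI[of _ "\<theta> * M + c + \<rho>"] exI[of _ s]) auto
qed

theorem lemma2:
  fixes G :: "'r::finite \<Rightarrow> 'n::finite pair_pre_digraph"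
    and A :: "'r \<Rightarrow> real^'n^'n"
    and \<delta> :: "nat \<Rightarrow> 'r"
    and g :: "'n \<Rightarrow> real^'m \<Rightarrow> real"
    and grad :: "'n \<Rightarrow> real^'m \<Rightarrow> real^'m"
    and l :: "'n \<Rightarrow> real"
    and C :: "'n \<Rightarrow> real^'m"
    and h :: real
    and \<beta> \<theta> \<rho> c \<tau> :: "'n \<Rightarrow> real"
    and X Xhat :: "'n \<Rightarrow> nat \<Rightarrow> real^'m"
    and Z :: "'n \<Rightarrow> int \<Rightarrow> real^'m"
    and trig :: "'n \<Rightarrow> nat \<Rightarrow> enat"
    and \<phi> \<eta> :: "'n \<Rightarrow> nat \<Rightarrow> real"
    and e :: "'n \<Rightarrow> nat \<Rightarrow> real^'m"
  assumes agents: "CARD('n) \<ge> 2"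
    and graphs: "\<And>p. connected_graph_on_agents (G p)"
    and adjacency: "\<And>p. weighted_adjacency_matrix (G p) (A p)"
    and g_convex: "\<And>i. convex_on UNIV (g i)"
    and g_gradient: "\<And>i x. GDERIV (g i) x :> grad i x"
    and grad_continuous: "\<And>i. continuous_on UNIV (grad i)"
    and grad_lipschitz: "\<And>i. (l i)-lipschitz_on UNIV (grad i)"
    and h_pos: "h > 0"
    and \<beta>_range: "\<And>i. \<beta> i \<in> {0<..<1}"
    and \<theta>_range: "\<And>i. \<theta> i \<in> {0<..<1}"
    and \<rho>_pos: "\<And>i. \<rho> i > 0"
    and c_gt_1: "\<And>i. c i > 1"
    and \<tau>_range: "\<And>i. 0 < \<tau> i \<and> \<tau> i < 1 - \<theta> i"
    and \<eta>_init: "\<And>i. \<eta> i 0 > 0"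
    and Xhat_init: "\<And>i. Xhat i 0 = X i 0"
    and Z_init: "\<And>i. Z i (- 1) = 0"
    and Z_step: "\<And>i k. Z i (int k) =
          Z i (int k - 1) + gradient_disagreement (A (\<delta> k)) grad (\<lambda>j. Xhat j k) i"
    and X_step: "\<And>i k. X i (Suc k) =
          C i - (2 * h) *\<^sub>R Z i (int k) + h *\<^sub>R Z i (int k - 1)"
    \<comment> \<open>natural subtraction: at time 0 the stored values are those at time 0\<close>
    and \<phi>_def: "\<And>i k. \<phi> i k = \<rho> i * \<beta> i ^ k /
          (1 + norm (gradient_disagreement (A (\<delta> k)) grad (\<lambda>j. Xhat j (k - 1)) i))"
    and trig_0: "\<And>i. trig i 0 = 0"
    and trig_Suc: "\<And>i t. trig i (Suc t) = next_trigger_time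
          (\<lambda>k. norm (grad i (X i k) - grad i (X i (the_enat (trig i t))))
                 \<ge> \<theta> i * \<eta> i k + c i * \<beta> i ^ k + \<phi> i k)
          (trig i t)"
    and Xhat_hold: "\<And>i t k. trig i t \<le> enat k \<Longrightarrow> enat k < trig i (Suc t) \<Longrightarrow>
          Xhat i k = X i (the_enat (trig i t))"
    and e_def: "\<And>i k. e i k = grad i (X i k) - grad i (Xhat i k)"
    and \<eta>_step: "\<And>i k. \<eta> i (Suc k) =
          (1 - \<tau> i) * \<eta> i k + c i * \<beta> i ^ k + \<phi> i k - norm (e i k)"
  shows "\<exists>\<alpha> :: nat \<Rightarrow> real. decseq \<alpha> \<and> summable \<alpha> \<and>
           (\<forall>i k. norm (e i k) \<le> \<alpha> k)"
proof -
  have \<phi>_bounds: "0 \<le> \<phi> i k \<and> \<phi> i k \<le> \<rho> i * \<beta> i ^ k" for i k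
  proof -
    have "0 \<le> \<rho> i * \<beta> i ^ k" using \<rho>_pos[of i] \<beta>_range[of i] by simp
    \<comment> \<open>The denominator in \<open>\<phi>\<close> is at least 1, whatever the
      residual.\<close>
    then show ?thesis
      unfolding \<phi>_def using divide_left_mono[of 1 "1 + norm x" "\<rho> i * \<beta> i ^ k" for x]
      by (simp add: add_pos_nonneg)
  qed
  have e_bound: "norm (e i k) = 0 \<or> norm (e i k) \<le> \<theta> i * \<eta> i k + c i * \<beta> i ^ k + \<phi> i k" for i k
  proof -
    have "\<exists>t. trig i t \<le> enat k \<and> enat k < trig i (Suc t)"
      by (rule exists_trigger_interval) (simp_all add: trig_0 trig_Suc next_trigger_time_gt)
    then obtain t where t: "trig i t \<le> enat k" "enat k < trig i (Suc t)" by blast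
    then have e: "e i k = grad i (X i k) - grad i (X i (the_enat (trig i t)))"
      by (simp add: e_def Xhat_hold)
    show ?thesis
    \<comment> \<open>At the left end of the interval the held state is the current one, so the
      error vanishes; strictly inside, the triggering condition fails.\<close>
    proof (cases "trig i t = enat k")
      case True
      then show ?thesis by (simp add: e)
    next
      case False
      with t have "trig i t < enat k" by simp
      from not_before_next_trigger_time[OF this t(2)[unfolded trig_Suc]] show ?thesis
        by (simp add: e)
    qed
  qed
  have "\<exists>K s. 0 \<le> K \<and> 0 \<le> s \<and> s < 1 \<and> (\<forall>k. norm (e i k) \<le> K * s ^ k)" for i
    by (rule dynamic_threshold_geometric_error[where \<eta> = "\<eta> i" and \<phi> = "\<phi> i" and \<beta> = "\<beta> i"
          and \<theta> = "\<theta> i" and \<tau> = "\<tau> i" and c = "c i" and \<rho> = "\<rho> i"])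
      (use \<beta>_range[of i] \<theta>_range[of i] \<tau>_range[of i] c_gt_1[of i] \<eta>_init[of i] \<phi>_bounds[of i]
        e_bound[of i] \<eta>_step[of i] in auto)
  then obtain K s where K: "\<And>i. 0 \<le> K i" and s: "\<And>i. 0 \<le> s i" "\<And>i. s i < 1"
    and bound: "\<And>i k. norm (e i k) \<le> K i * s i ^ k"
    by metis
  \<comment> \<open>Each summand is nonnegative, nonincreasing and summable, and a finite sum of
    such terms keeps these properties while dominating every single term.\<close>
  define \<alpha> where "\<alpha> k = (\<Sum>i\<in>UNIV. K i * s i ^ k)" for k
  have "decseq \<alpha>"
    unfolding \<alpha>_def decseq_def using K s
    by (auto intro!: sum_mono mult_left_mono power_decreasing simp: less_imp_le)
  moreover have "summable \<alpha>"
    unfolding \<alpha>_def using s by (auto intro!: summable_sum summable_mult summable_geometric)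
  moreover have "norm (e i k) \<le> \<alpha> k" for i k
  proof -
    have "K i * s i ^ k \<le> \<alpha> k"
      unfolding \<alpha>_def using K s by (intro member_le_sum) auto
    with bound show ?thesis by (rule order_trans)
  qed
  ultimately show ?thesis by blast
qed

end
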